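(* If $X$ and $Y$ are walkable graphs which are N-equivalent, then the basal graphs of $X$ and $Y$ are isomorphic.
   Context: A graph is $X=(X_0,X_1,s,t)$ with a set $X_0$ of nodes, a set $X_1$ of arcs, and functions $s,t:X_1\to X_0$ (source and target); loops, multiple arcs and infinite graphs are allowed. Graph morphisms are pairs of functions on nodes and arcs commuting with $s$ and $t$. $\mathbf{N}$ is the graph with nodes the natural numbers and arcs $(n,n+1)$ from $n$ to $n+1$; a walk in $X$ is a graph morphism $\mathbf{N}\to X$, and its source is the image of node $0$. $N(X)$ is the set of walks in $X$ together with the shift $\tau:N(X)\to N(X)$ deleting the first arc of a walk. An N-set is a set with a self-map $\tau$, and isomorphisms of N-sets are bijections commuting with the self-maps. Graphs $X$ and $Y$ are N-equivalent (homotopy-equivalent for the N-equivalence model structure) when $N(X)$ and $N(Y)$ are isomorphic N-sets. $X$ is walkable when it equals its walkable subgraph (the subgraph of nodes and arcs that occur as the first node, resp. first arc, of a walk in $X$), equivalently when every node of $X$ is the source of some walk. $X( *,x)$ is the set of arcs of $X$ with target $x$. A graph morphism $f:X\to Y$ is a covering when $f:X( *,x)\to Y( *,f(x))$ is a bijection for every node $x$ of $X$; an epic covering is a covering surjective on nodes. A graph $B$ is basal when the only epic coverings $B\to B'$ are isomorphisms. The basal graph of $X$ is the codomain $B$ of any epic covering $p:X\to B$ with $B$ basal; it exists and is well-defined up to isomorphism. *)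

theory Defs
  imports "Graph_Theory.Graph_Theory"
begin

text \<open>
  A graph is a \<^const>\<open>wf_digraph\<close>: loops, multiple arcs, infinite graphs and the empty graph are all
  allowed.  The target function is \<^const>\<open>head\<close> and the source function is \<^const>\<open>tail\<close>.
\<close>

type_synonym ('a, 'b, 'c, 'd) graph_map = "('a \<Rightarrow> 'c) \<times> ('b \<Rightarrow> 'd)"

definition graph_morphism ::
  "('a, 'b) pre_digraph \<Rightarrow> ('c, 'd) pre_digraph \<Rightarrow> ('a, 'b, 'c, 'd) graph_map \<Rightarrow> bool" where
  "graph_morphism X Y f \<longleftrightarrow> wf_digraph X \<and> wf_digraph Y \<and>
     fst f ` verts X \<subseteq> verts Y \<and> snd f ` arcs X \<subseteq> arcs Y \<and>
     (\<forall>e \<in> arcs X. tail Y (snd f e) = fst f (tail X e) \<and> head Y (snd f e) = fst f (head X e))"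

definition graph_isomorphism ::
  "('a, 'b) pre_digraph \<Rightarrow> ('c, 'd) pre_digraph \<Rightarrow> ('a, 'b, 'c, 'd) graph_map \<Rightarrow> bool" where
  "graph_isomorphism X Y f \<longleftrightarrow> graph_morphism X Y f \<and>
     bij_betw (fst f) (verts X) (verts Y) \<and> bij_betw (snd f) (arcs X) (arcs Y)"

lemma digraph_iso_iff_graph_isomorphism:
  assumes "wf_digraph X" "wf_digraph Y"
  shows "digraph_iso X Y \<longleftrightarrow> (\<exists>f. graph_isomorphism X Y f)"
proof
  assume "digraph_iso X Y"
  then obtain h where h: "pre_digraph.digraph_isomorphism X h" and Y: "Y = app_iso h X"
    by (auto simp: digraph_iso_def)
  have "graph_isomorphism X Y (iso_verts h, iso_arcs h)"
    using h assms unfolding Y graph_isomorphism_def graph_morphism_def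
      pre_digraph.digraph_isomorphism_def bij_betw_def by auto
  then show "\<exists>f. graph_isomorphism X Y f" ..
next
  assume "\<exists>f. graph_isomorphism X Y f"
  then obtain f where f: "graph_isomorphism X Y f" ..
  let ?h = "\<lparr> iso_verts = fst f, iso_arcs = snd f, iso_head = head Y, iso_tail = tail Y \<rparr>"
  have "pre_digraph.digraph_isomorphism X ?h"
    using f by (auto simp: pre_digraph.digraph_isomorphism_def graph_isomorphism_def
        graph_morphism_def bij_betw_def)
  moreover have "Y = app_iso ?h X"
    using f by (auto simp: app_iso_def graph_isomorphism_def bij_betw_def)
  ultimately show "digraph_iso X Y" by (auto simp: digraph_iso_def)
qed

text \<open>
  The arc from \<open>n\<close> to \<open>Suc n\<close> is named \<open>n\<close>.  Nodes and arcs thus exhaust their types, so a morphism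
  out of this graph is determined by its underlying pair of functions, and \<open>walks X\<close> below contains
  every walk exactly once.
\<close>

definition nat_graph :: "(nat, nat) pre_digraph" where
  "nat_graph = \<lparr> verts = UNIV, arcs = UNIV, tail = (\<lambda>n. n), head = Suc \<rparr>"

type_synonym ('a, 'b) walk = "(nat, nat, 'a, 'b) graph_map"

definition walks :: "('a, 'b) pre_digraph \<Rightarrow> ('a, 'b) walk set" where
  "walks X = {w. graph_morphism nat_graph X w}"

definition shift :: "('a, 'b) walk \<Rightarrow> ('a, 'b) walk" where
  "shift w = (\<lambda>n. fst w (Suc n), \<lambda>n. snd w (Suc n))"

lemma shift_in_walks: "w \<in> walks X \<Longrightarrow> shift w \<in> walks X"
  by (auto simp: walks_def shift_def graph_morphism_def nat_graph_def)

definition N_set_iso :: "'v set \<Rightarrow> ('v \<Rightarrow> 'v) \<Rightarrow> 'w set \<Rightarrow> ('w \<Rightarrow> 'w) \<Rightarrow> bool" where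
  "N_set_iso S \<sigma> T \<tau> \<longleftrightarrow> (\<exists>\<phi>. bij_betw \<phi> S T \<and> (\<forall>x \<in> S. \<phi> (\<sigma> x) = \<tau> (\<phi> x)))"

definition N_equivalent :: "('a, 'b) pre_digraph \<Rightarrow> ('c, 'd) pre_digraph \<Rightarrow> bool" where
  "N_equivalent X Y \<longleftrightarrow> N_set_iso (walks X) shift (walks Y) shift"

definition walkable_subgraph :: "('a, 'b) pre_digraph \<Rightarrow> ('a, 'b) pre_digraph" where
  "walkable_subgraph X =
     X \<lparr> verts := (\<lambda>w. fst w 0) ` walks X, arcs := (\<lambda>w. snd w 0) ` walks X \<rparr>"

definition walkable :: "('a, 'b) pre_digraph \<Rightarrow> bool" where
  "walkable X \<longleftrightarrow> walkable_subgraph X = X"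

definition covering ::
  "('a, 'b) pre_digraph \<Rightarrow> ('c, 'd) pre_digraph \<Rightarrow> ('a, 'b, 'c, 'd) graph_map \<Rightarrow> bool" where
  "covering X Y f \<longleftrightarrow> graph_morphism X Y f \<and>
     (\<forall>x \<in> verts X. bij_betw (snd f) (in_arcs X x) (in_arcs Y (fst f x)))"

definition epic_covering ::
  "('a, 'b) pre_digraph \<Rightarrow> ('c, 'd) pre_digraph \<Rightarrow> ('a, 'b, 'c, 'd) graph_map \<Rightarrow> bool" where
  "epic_covering X Y f \<longleftrightarrow> covering X Y f \<and> fst f ` verts X = verts Y"

text \<open>
  A definition cannot quantify over types, so the codomain \<open>B'\<close> has the node and arc types of \<open>B\<close>.
  This is no restriction: the lemma \<open>basal_epic_covering_iso\<close> below gives the property for codomains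
  of arbitrary types.
\<close>

definition basal :: "('a, 'b) pre_digraph \<Rightarrow> bool" where
  "basal B \<longleftrightarrow> wf_digraph B \<and>
     (\<forall>(B' :: ('a, 'b) pre_digraph) f. epic_covering B B' f \<longrightarrow> graph_isomorphism B B' f)"

lemma epic_covering_arcs:
  assumes "epic_covering X Y f"
  shows "snd f ` arcs X = arcs Y"
proof
  show "snd f ` arcs X \<subseteq> arcs Y"
    using assms by (auto simp: epic_covering_def covering_def graph_morphism_def)
  show "arcs Y \<subseteq> snd f ` arcs X"
  proof
    fix e assume e: "e \<in> arcs Y"
    have "wf_digraph Y"
      using assms by (auto simp: epic_covering_def covering_def graph_morphism_def)
    then have "head Y e \<in> verts Y" using e by (rule wf_digraph.head_in_verts)
    then obtain x where x: "x \<in> verts X" "fst f x = head Y e"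
      using assms unfolding epic_covering_def by (metis imageE)
    then have "snd f ` in_arcs X x = in_arcs Y (head Y e)"
      using assms by (auto simp: epic_covering_def covering_def bij_betw_def)
    with e show "e \<in> snd f ` arcs X" by (auto simp: in_arcs_def)
  qed
qed

lemma basal_epic_covering_iso:
  fixes B :: "('a, 'b) pre_digraph" and B' :: "('c, 'd) pre_digraph"
  assumes basal: "basal B" and epi: "epic_covering B B' f"
  shows "graph_isomorphism B B' f"
proof -
  have mor: "graph_morphism B B' f" and V: "fst f ` verts B = verts B'"
    using epi by (auto simp: epic_covering_def covering_def)
  have cov: "bij_betw (snd f) (in_arcs B x) (in_arcs B' (fst f x))" if "x \<in> verts B" for x
    using epi that by (auto simp: epic_covering_def covering_def)
  have A: "snd f ` arcs B = arcs B'" using epi by (rule epic_covering_arcs)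
  have wf: "wf_digraph B" "wf_digraph B'" using mor by (auto simp: graph_morphism_def)
  define g0 where "g0 = inv_into (verts B) (fst f)"
  define g1 where "g1 = inv_into (arcs B) (snd f)"
  have g0: "fst f (g0 y) = y" if "y \<in> verts B'" for y
    unfolding g0_def by (rule f_inv_into_f) (use V that in auto)
  have g1: "snd f (g1 e) = e" if "e \<in> arcs B'" for e
    unfolding g1_def by (rule f_inv_into_f) (use A that in auto)
  have inj0: "inj_on g0 (verts B')" by (metis g0 inj_onI)
  have inj1: "inj_on g1 (arcs B')" by (metis g1 inj_onI)
  define C where "C = \<lparr> verts = g0 ` verts B', arcs = g1 ` arcs B',
    tail = (\<lambda>e. g0 (tail B' (snd f e))), head = (\<lambda>e. g0 (head B' (snd f e))) \<rparr>"
  have wfC: "wf_digraph C"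
    using wf by unfold_locales (auto simp: C_def g1 wf_digraph.tail_in_verts wf_digraph.head_in_verts)
  have g1f: "snd f (g1 (snd f e)) = snd f e" if "e \<in> arcs B" for e
    by (rule g1) (use A that in auto)
  let ?h = "(\<lambda>x. g0 (fst f x), \<lambda>e. g1 (snd f e))"
  have morC: "graph_morphism B C ?h"
    using wf wfC mor V A by (auto simp: graph_morphism_def C_def g1f)
  have inC: "in_arcs C (g0 y) = g1 ` in_arcs B' y" if "y \<in> verts B'" for y
    using that inj0 wf by (auto simp: in_arcs_def C_def g1 wf_digraph.head_in_verts dest: inj_onD)
  have "epic_covering B C ?h"
    unfolding epic_covering_def covering_def
  proof (intro conjI ballI)
    fix x assume x: "x \<in> verts B"
    then have y: "fst f x \<in> verts B'" using V by auto
    have "bij_betw g1 (in_arcs B' (fst f x)) (g1 ` in_arcs B' (fst f x))"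
      by (rule inj_on_imp_bij_betw, rule inj_on_subset[OF inj1]) (auto simp: in_arcs_def)
    from bij_betw_trans[OF cov[OF x] this]
    show "bij_betw (snd ?h) (in_arcs B x) (in_arcs C (fst ?h x))"
      by (simp add: inC[OF y] comp_def)
  next
    show "fst ?h ` verts B = verts C" unfolding V[symmetric] C_def by (simp add: image_image V[symmetric])
  qed (rule morC)
  with basal have "graph_isomorphism B C ?h" unfolding basal_def by blast
  then have "inj_on (fst f) (verts B)" "inj_on (snd f) (arcs B)"
    by (auto simp: graph_isomorphism_def bij_betw_def inj_on_def)
  with mor V A show ?thesis by (auto simp: graph_isomorphism_def bij_betw_def)
qed

text \<open>
  The basal graph is only determined up to isomorphism, so it is treated as a relation between
  graphs.
\<close>

definition is_basal_graph_of :: "('c, 'd) pre_digraph \<Rightarrow> ('a, 'b) pre_digraph \<Rightarrow> bool" where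
  "is_basal_graph_of B X \<longleftrightarrow> basal B \<and> (\<exists>p. epic_covering X B p)"

end

(* The walks in X are the nodes of a graph with an arc from each walk w to its shift.  Sending a
   walk to its source and to its first arc is a covering of X, because prepending an arc to w is the
   choice of an arc into the source of w; it is epic when X is walkable.  This graph depends only on
   the N-set of walks, so the basal graphs of X and Y have a common epic covering.

   Coverings are functional cases of bisimulations: relations of nodes whose related pairs have
   in-arcs in bijection, with related tails.  Choosing one node in each class of the largest
   bisimulation on B and, for each node, a bijection to the in-arcs of the chosen one yields an
   epic covering out of B, so on a basal graph only equal nodes are bisimilar.  Two basal graphs
   with a common epic covering are therefore isomorphic. *)

theory Submission
  imports Defs
begin

section \<open>Bisimulations between graphs\<close>

text \<open>The bijection \<open>b\<close> may be chosen anew for each related pair, with no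
  coherence between choices, which keeps bisimulations closed under converse, composition and
  unions. Only tails are constrained, since the heads of the matched arcs are \<open>x\<close> and
  \<open>y\<close> themselves.\<close>

definition bisimulation ::
  "('a, 'b) pre_digraph \<Rightarrow> ('c, 'd) pre_digraph \<Rightarrow> ('a \<times> 'c) set \<Rightarrow> bool" where
  "bisimulation G H R \<longleftrightarrow> R \<subseteq> verts G \<times> verts H \<and>
     (\<forall>(x, y) \<in> R. \<exists>b. bij_betw b (in_arcs G x) (in_arcs H y) \<and>
        (\<forall>e \<in> in_arcs G x. (tail G e, tail H (b e)) \<in> R))"

lemma bisimulationI:
  assumes "R \<subseteq> verts G \<times> verts H"
    and "\<And>x y. (x, y) \<in> R \<Longrightarrow> \<exists>b. bij_betw b (in_arcs G x) (in_arcs H y) \<and>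
        (\<forall>e \<in> in_arcs G x. (tail G e, tail H (b e)) \<in> R)"
  shows "bisimulation G H R"
  using assms by (auto simp: bisimulation_def)

lemma bisimulation_verts:
  assumes "bisimulation G H R" "(x, y) \<in> R"
  shows "x \<in> verts G" "y \<in> verts H"
  using assms by (auto simp: bisimulation_def)

lemma bisimulationD:
  assumes "bisimulation G H R" "(x, y) \<in> R"
  shows "\<exists>b. bij_betw b (in_arcs G x) (in_arcs H y) \<and>
    (\<forall>e \<in> in_arcs G x. (tail G e, tail H (b e)) \<in> R)"
  using assms by (auto simp: bisimulation_def)

lemma bisimulation_Id_on:
  assumes "wf_digraph G"
  shows "bisimulation G G (Id_on (verts G))"
proof (rule bisimulationI)
  show "\<exists>b. bij_betw b (in_arcs G x) (in_arcs G y) \<and>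
      (\<forall>e \<in> in_arcs G x. (tail G e, tail G (b e)) \<in> Id_on (verts G))"
    if "(x, y) \<in> Id_on (verts G)" for x y
    using that assms by (intro exI[of _ id]) (auto simp: wf_digraph.tail_in_verts)
qed auto

lemma bisimulation_converse:
  assumes R: "bisimulation G H R"
  shows "bisimulation H G (R\<inverse>)"
proof (rule bisimulationI)
  show "R\<inverse> \<subseteq> verts H \<times> verts G" using R by (auto simp: bisimulation_def)
next
  fix y x assume "(y, x) \<in> R\<inverse>"
  then have "(x, y) \<in> R" by simp
  obtain b where b: "bij_betw b (in_arcs G x) (in_arcs H y)"
      "\<And>e. e \<in> in_arcs G x \<Longrightarrow> (tail G e, tail H (b e)) \<in> R"
    using bisimulationD[OF R \<open>(x, y) \<in> R\<close>] by blast
  let ?c = "inv_into (in_arcs G x) b"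
  have c: "bij_betw ?c (in_arcs H y) (in_arcs G x)" using b(1) by (rule bij_betw_inv_into)
  have "(tail H e, tail G (?c e)) \<in> R\<inverse>" if "e \<in> in_arcs H y" for e
    using b(2)[OF bij_betwE[OF c, rule_format, OF that]] bij_betw_inv_into_right[OF b(1) that] by simp
  with c show "\<exists>c. bij_betw c (in_arcs H y) (in_arcs G x) \<and>
      (\<forall>e \<in> in_arcs H y. (tail H e, tail G (c e)) \<in> R\<inverse>)"
    by blast
qed

lemma bisimulation_relcomp:
  assumes R: "bisimulation G H R" and S: "bisimulation H K S"
  shows "bisimulation G K (R O S)"
proof (rule bisimulationI)
  show "R O S \<subseteq> verts G \<times> verts K" using R S by (auto simp: bisimulation_def)
next
  fix x z assume "(x, z) \<in> R O S"
  then obtain y where y: "(x, y) \<in> R" "(y, z) \<in> S" by blast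
  obtain b where b: "bij_betw b (in_arcs G x) (in_arcs H y)"
      "\<And>e. e \<in> in_arcs G x \<Longrightarrow> (tail G e, tail H (b e)) \<in> R"
    using bisimulationD[OF R y(1)] by blast
  obtain c where c: "bij_betw c (in_arcs H y) (in_arcs K z)"
      "\<And>e. e \<in> in_arcs H y \<Longrightarrow> (tail H e, tail K (c e)) \<in> S"
    using bisimulationD[OF S y(2)] by blast
  have "(tail G e, tail K ((c \<circ> b) e)) \<in> R O S" if "e \<in> in_arcs G x" for e
    using b(2)[OF that] c(2)[OF bij_betwE[OF b(1), rule_format, OF that]] by auto
  with bij_betw_trans[OF b(1) c(1)]
  show "\<exists>d. bij_betw d (in_arcs G x) (in_arcs K z) \<and>
      (\<forall>e \<in> in_arcs G x. (tail G e, tail K (d e)) \<in> R O S)"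
    by blast
qed

text \<open>A bijection that works for one member \<open>R\<close> still works for any relation
  containing \<open>R\<close>. This makes a largest bisimulation available.\<close>

lemma bisimulation_Union:
  assumes "\<And>R. R \<in> \<R> \<Longrightarrow> bisimulation G H R"
  shows "bisimulation G H (\<Union>\<R>)"
proof (rule bisimulationI)
  show "\<Union>\<R> \<subseteq> verts G \<times> verts H" using assms by (fastforce simp: bisimulation_def)
next
  fix x y assume "(x, y) \<in> \<Union>\<R>"
  then obtain R where "R \<in> \<R>" "(x, y) \<in> R" by blast
  with bisimulationD[OF assms[OF this(1)] this(2)]
  show "\<exists>b. bij_betw b (in_arcs G x) (in_arcs H y) \<and>
      (\<forall>e \<in> in_arcs G x. (tail G e, tail H (b e)) \<in> \<Union>\<R>)"
    by blast
qed

lemma covering_bisimulation: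
  assumes f: "covering G H f"
  shows "bisimulation G H {(x, fst f x) | x. x \<in> verts G}"
proof (rule bisimulationI)
  show "{(x, fst f x) | x. x \<in> verts G} \<subseteq> verts G \<times> verts H"
    using f by (auto simp: covering_def graph_morphism_def)
next
  fix x y assume "(x, y) \<in> {(x, fst f x) | x. x \<in> verts G}"
  then have x: "x \<in> verts G" and y: "y = fst f x" by auto
  have wf: "wf_digraph G" using f by (simp add: covering_def graph_morphism_def)
  show "\<exists>b. bij_betw b (in_arcs G x) (in_arcs H y) \<and>
      (\<forall>e \<in> in_arcs G x. (tail G e, tail H (b e)) \<in> {(x, fst f x) | x. x \<in> verts G})"
  proof (intro exI conjI ballI)
    show "bij_betw (snd f) (in_arcs G x) (in_arcs H y)" using f x y by (simp add: covering_def)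
    show "(tail G e, tail H (snd f e)) \<in> {(x, fst f x) | x. x \<in> verts G}"
      if "e \<in> in_arcs G x" for e
      using f that wf_digraph.tail_in_verts[OF wf] by (auto simp: covering_def graph_morphism_def)
  qed
qed

section \<open>Quotients by bisimulations, and bisimilarity on a basal graph\<close>

text \<open>The quotient is built on representatives rather than on classes, so that
  \<open>Q\<close> keeps the node and arc types of \<open>G\<close>, as the codomains in
  \<open>basal\<close> do.\<close>

lemma bisimulation_quotient:
  fixes G :: "('a, 'b) pre_digraph"
  assumes wf: "wf_digraph G" and M: "bisimulation G G M" and equiv: "equiv (verts G) M"
  obtains Q :: "('a, 'b) pre_digraph" and f
  where "epic_covering G Q f" "\<And>x y. (x, y) \<in> M \<Longrightarrow> fst f x = fst f y"
proof -
  define c where "c x = (SOME y. y \<in> M `` {x})" for x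
  have cM: "(x, c x) \<in> M" if "x \<in> verts G" for x
  proof -
    have "\<exists>y. y \<in> M `` {x}" using equiv_class_self[OF equiv that] by blast
    then show ?thesis unfolding c_def by (metis Image_singleton_iff someI_ex)
  qed
  have c_eq: "c x = c y" if "(x, y) \<in> M" for x y
    using equiv_class_eq[OF equiv that] by (simp add: c_def)
  have cV: "c x \<in> verts G" if "x \<in> verts G" for x
    using bisimulation_verts[OF M cM[OF that]] by blast
  have "\<exists>b. bij_betw b (in_arcs G x) (in_arcs G (c x)) \<and>
      (\<forall>e \<in> in_arcs G x. (tail G e, tail G (b e)) \<in> M)" if "x \<in> verts G" for x
    using bisimulationD[OF M cM[OF that]] .
  then obtain b where b: "\<And>x. x \<in> verts G \<Longrightarrow> bij_betw (b x) (in_arcs G x) (in_arcs G (c x))"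
      "\<And>x e. x \<in> verts G \<Longrightarrow> e \<in> in_arcs G x \<Longrightarrow> (tail G e, tail G (b x e)) \<in> M"
    by metis
  \<comment> \<open>Arcs into representatives are kept with their heads, and their tails are moved
    to representatives. Under \<open>f\<close>, an arc into any other node \<open>x\<close> is
    carried by \<open>b x\<close> to an arc into \<open>c x\<close>; the tail of its image in
    \<open>G\<close> is only \<open>M\<close>-related to its own tail, and \<open>c\<close> makes
    the two equal.\<close>
  define Q where "Q = \<lparr> verts = c ` verts G, arcs = {e \<in> arcs G. head G e \<in> c ` verts G},
    tail = (\<lambda>e. c (tail G e)), head = head G \<rparr>"
  define f where "f = (c, \<lambda>e. b (head G e) e)"
  have wfQ: "wf_digraph Q"
    using wf by unfold_locales (auto simp: Q_def wf_digraph.tail_in_verts)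
  have inQ: "in_arcs Q (c x) = in_arcs G (c x)" if "x \<in> verts G" for x
    using that by (auto simp: Q_def in_arcs_def)
  have arc: "b (head G e) e \<in> in_arcs G (c (head G e))" "c (tail G (b (head G e) e)) = c (tail G e)"
    if "e \<in> arcs G" for e
  proof -
    have h: "head G e \<in> verts G" using wf that by (rule wf_digraph.head_in_verts)
    have e: "e \<in> in_arcs G (head G e)" using that by simp
    show "b (head G e) e \<in> in_arcs G (c (head G e))"
      using bij_betwE[OF b(1)[OF h]] e by blast
    show "c (tail G (b (head G e) e)) = c (tail G e)"
      using c_eq[OF b(2)[OF h e]] by simp
  qed
  have mor: "graph_morphism G Q f"
    using wf wfQ arc by (auto simp: graph_morphism_def Q_def f_def wf_digraph.head_in_verts)
  have "bij_betw (snd f) (in_arcs G x) (in_arcs Q (fst f x))" if "x \<in> verts G" for x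
  proof -
    have "bij_betw (snd f) (in_arcs G x) (in_arcs Q (fst f x)) \<longleftrightarrow>
        bij_betw (b x) (in_arcs G x) (in_arcs G (c x))"
      using inQ[OF that] by (auto simp: f_def intro!: bij_betw_cong)
    with b(1)[OF that] show ?thesis by simp
  qed
  with mor have "epic_covering G Q f"
    by (auto simp: epic_covering_def covering_def f_def Q_def)
  moreover have "fst f x = fst f y" if "(x, y) \<in> M" for x y
    using c_eq[OF that] by (simp add: f_def)
  ultimately show thesis by (rule that)
qed

lemma basal_bisimulation_subset_Id:
  assumes B: "basal B" and R: "bisimulation B B R"
  shows "R \<subseteq> Id"
proof -
  have wf: "wf_digraph B" using B by (simp add: basal_def)
  define M where "M = \<Union>{R. bisimulation B B R}"
  have M: "bisimulation B B M" unfolding M_def by (rule bisimulation_Union) simp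
  have le: "S \<subseteq> M" if "bisimulation B B S" for S using that by (auto simp: M_def)
  \<comment> \<open>Since \<open>M\<close> is largest, it contains the diagonal, its own converse
    and its own square, because each is a bisimulation.\<close>
  have "equiv (verts B) M"
  proof (rule equivI)
    show "M \<subseteq> verts B \<times> verts B" using M by (simp add: bisimulation_def)
    show "refl_on (verts B) M"
      using le[OF bisimulation_Id_on[OF wf]] by (auto simp: refl_on_def)
    show "sym M" using le[OF bisimulation_converse[OF M]] by (auto simp: sym_def)
    show "trans M" using le[OF bisimulation_relcomp[OF M M]] by (auto simp: trans_def)
  qed
  with wf M obtain Q :: "('a, 'b) pre_digraph" and f where
    f: "epic_covering B Q f" "\<And>x y. (x, y) \<in> M \<Longrightarrow> fst f x = fst f y"
    by (rule bisimulation_quotient) blast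
  have "graph_isomorphism B Q f" using B f(1) unfolding basal_def by blast
  then have inj: "inj_on (fst f) (verts B)" by (simp add: graph_isomorphism_def bij_betw_def)
  show ?thesis
  proof (rule subrelI)
    fix x y assume xy: "(x, y) \<in> R"
    with le[OF R] have "fst f x = fst f y" by (intro f(2)) auto
    with inj bisimulation_verts[OF R xy] show "(x, y) \<in> Id" by (simp add: inj_on_eq_iff)
  qed
qed

section \<open>Isomorphisms obtained from bisimulations\<close>

text \<open>In-arc sets partition the arcs by their heads, so the unrelated local bijections glue to
  one arc map, bijective because \<open>h\<close> is bijective on heads.\<close>

lemma bisimulation_graph_isomorphism:
  assumes wf: "wf_digraph G" "wf_digraph H"
    and h: "bij_betw h (verts G) (verts H)"
    and R: "bisimulation G H {(x, h x) | x. x \<in> verts G}"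
  shows "\<exists>f. graph_isomorphism G H f"
proof -
  have "\<exists>b. bij_betw b (in_arcs G x) (in_arcs H (h x)) \<and>
      (\<forall>e \<in> in_arcs G x. tail H (b e) = h (tail G e))" if "x \<in> verts G" for x
  proof -
    have "(x, h x) \<in> {(x, h x) | x. x \<in> verts G}" using that by blast
    from bisimulationD[OF R this] obtain b where "bij_betw b (in_arcs G x) (in_arcs H (h x))"
        "\<forall>e \<in> in_arcs G x. (tail G e, tail H (b e)) \<in> {(x, h x) | x. x \<in> verts G}" by blast
    then show ?thesis by (intro exI[of _ b]) auto
  qed
  then obtain b where b: "\<And>x. x \<in> verts G \<Longrightarrow> bij_betw (b x) (in_arcs G x) (in_arcs H (h x))"
      "\<And>x e. x \<in> verts G \<Longrightarrow> e \<in> in_arcs G x \<Longrightarrow> tail H (b x e) = h (tail G e)"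
    by metis
  let ?g = "\<lambda>e. b (head G e) e"
  have arc: "?g e \<in> in_arcs H (h (head G e))" "tail H (?g e) = h (tail G e)"
    if "e \<in> arcs G" for e
  proof -
    have x: "head G e \<in> verts G" using wf(1) that by (rule wf_digraph.head_in_verts)
    have e: "e \<in> in_arcs G (head G e)" using that by simp
    show "?g e \<in> in_arcs H (h (head G e))" using bij_betwE[OF b(1)[OF x]] e by blast
    show "tail H (?g e) = h (tail G e)" using b(2)[OF x e] .
  qed
  have mor: "graph_morphism G H (h, ?g)"
    using wf arc bij_betwE[OF h] by (auto simp: graph_morphism_def)
  have "bij_betw ?g (arcs G) (arcs H)"
  proof (rule bij_betw_imageI)
    show "inj_on ?g (arcs G)"
    proof (rule inj_onI)
      fix e e' assume e: "e \<in> arcs G" "e' \<in> arcs G" and eq: "?g e = ?g e'"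
      have v: "head G e \<in> verts G" "head G e' \<in> verts G"
        using wf(1) e by (auto simp: wf_digraph.head_in_verts)
      have "h (head G e) = h (head G e')" using arc(1)[OF e(1)] arc(1)[OF e(2)] eq by simp
      then have "head G e = head G e'" using h v by (auto simp: bij_betw_def dest: inj_onD)
      with eq e b(1)[OF v(1)] show "e = e'" by (auto simp: bij_betw_def dest: inj_onD)
    qed
    show "?g ` arcs G = arcs H"
    proof
      show "?g ` arcs G \<subseteq> arcs H" using arc(1) by auto
      show "arcs H \<subseteq> ?g ` arcs G"
      proof
        fix e assume e: "e \<in> arcs H"
        then have "head H e \<in> verts H" using wf(2) by (simp add: wf_digraph.head_in_verts)
        then obtain x where x: "x \<in> verts G" "h x = head H e"
          using h unfolding bij_betw_def by (metis imageE)
        have "b x ` in_arcs G x = in_arcs H (head H e)"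
          using b(1)[OF x(1)] x(2) by (simp add: bij_betw_def)
        with e have "e \<in> b x ` in_arcs G x" by simp
        then show "e \<in> ?g ` arcs G" by auto
      qed
    qed
  qed
  with mor h have "graph_isomorphism G H (h, ?g)" by (simp add: graph_isomorphism_def)
  then show ?thesis ..
qed

text \<open>\<open>R O R\<inverse>\<close> is a bisimulation on \<open>B\<close> and
  \<open>R\<inverse> O R\<close> one on \<open>C\<close>; both lie in the identity, so
  \<open>R\<close> is injective and single-valued. With full domain and range it is the graph of a
  bijection.\<close>

lemma basal_bisimulation_isomorphism:
  assumes B: "basal B" and C: "basal C" and R: "bisimulation B C R"
    and dom: "Domain R = verts B" and ran: "Range R = verts C"
  shows "\<exists>f. graph_isomorphism B C f"
proof -
  have wf: "wf_digraph B" "wf_digraph C" using B C by (simp_all add: basal_def)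
  have "R O R\<inverse> \<subseteq> Id"
    using B bisimulation_relcomp[OF R bisimulation_converse[OF R]]
    by (rule basal_bisimulation_subset_Id)
  then have left: "x = x'" if "(x, y) \<in> R" "(x', y) \<in> R" for x x' y using that by auto
  have "R\<inverse> O R \<subseteq> Id"
    using C bisimulation_relcomp[OF bisimulation_converse[OF R] R]
    by (rule basal_bisimulation_subset_Id)
  then have right: "y = y'" if "(x, y) \<in> R" "(x, y') \<in> R" for x y y' using that by auto
  have "\<forall>x \<in> verts B. \<exists>y. (x, y) \<in> R" using dom by blast
  then obtain h where h: "\<And>x. x \<in> verts B \<Longrightarrow> (x, h x) \<in> R" by metis
  have R_eq: "R = {(x, h x) | x. x \<in> verts B}"
  proof
    show "R \<subseteq> {(x, h x) | x. x \<in> verts B}"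
    proof (rule subrelI)
      fix x y assume xy: "(x, y) \<in> R"
      have x: "x \<in> verts B" using R xy by (rule bisimulation_verts)
      with right[OF xy h[OF x]] show "(x, y) \<in> {(x, h x) | x. x \<in> verts B}" by simp
    qed
    show "{(x, h x) | x. x \<in> verts B} \<subseteq> R" using h by auto
  qed
  have "bij_betw h (verts B) (verts C)"
  proof (rule bij_betw_imageI)
    show "inj_on h (verts B)" by (rule inj_onI) (metis h left)
    show "h ` verts B = verts C" using ran R_eq by auto
  qed
  then show ?thesis using R unfolding R_eq by (rule bisimulation_graph_isomorphism[OF wf])
qed

lemma epic_covering_basal_unique:
  assumes p: "epic_covering Z B p" and q: "epic_covering Z C q" and "basal B" "basal C"
  shows "\<exists>f. graph_isomorphism B C f"
proof -
  let ?P = "{(z, fst p z) | z. z \<in> verts Z}" and ?Q = "{(z, fst q z) | z. z \<in> verts Z}"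
  have p': "covering Z B p" "fst p ` verts Z = verts B"
    and q': "covering Z C q" "fst q ` verts Z = verts C"
    using p q by (simp_all add: epic_covering_def)
  \<comment> \<open>Nodes of \<open>B\<close> and \<open>C\<close> are related when they are the
    images of a common node of \<open>Z\<close>.\<close>
  have "bisimulation B C (?P\<inverse> O ?Q)"
    by (rule bisimulation_relcomp[OF bisimulation_converse[OF covering_bisimulation[OF p'(1)]]
          covering_bisimulation[OF q'(1)]])
  moreover have "Domain (?P\<inverse> O ?Q) = verts B" "Range (?P\<inverse> O ?Q) = verts C"
    unfolding p'(2)[symmetric] q'(2)[symmetric] by (auto simp: Domain_iff Range_iff)
  ultimately show ?thesis
    by (rule basal_bisimulation_isomorphism[OF \<open>basal B\<close> \<open>basal C\<close>])
qed

section \<open>Epic coverings, graphs of N-sets, and walks\<close>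

lemma epic_covering_compose:
  assumes f: "epic_covering G H f" and g: "epic_covering H K g"
  shows "epic_covering G K (fst g \<circ> fst f, snd g \<circ> snd f)"
proof -
  have mor: "graph_morphism G H f" "graph_morphism H K g"
    using f g by (auto simp: epic_covering_def covering_def)
  have "bij_betw (snd g \<circ> snd f) (in_arcs G x) (in_arcs K (fst g (fst f x)))"
    if x: "x \<in> verts G" for x
  proof (rule bij_betw_trans)
    show "bij_betw (snd f) (in_arcs G x) (in_arcs H (fst f x))"
      using f x by (simp add: epic_covering_def covering_def)
    have "fst f x \<in> verts H" using mor(1) x by (auto simp: graph_morphism_def)
    then show "bij_betw (snd g) (in_arcs H (fst f x)) (in_arcs K (fst g (fst f x)))"
      using g by (simp add: epic_covering_def covering_def)
  qed
  moreover have "graph_morphism G K (fst g \<circ> fst f, snd g \<circ> snd f)"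
    using mor by (auto simp: graph_morphism_def image_subset_iff)
  moreover have "(fst g \<circ> fst f) ` verts G = verts K"
    using f g unfolding epic_covering_def by (metis image_comp)
  ultimately show ?thesis by (simp add: epic_covering_def covering_def)
qed

text \<open>This is the functional graph of the self-map: each arc is named by its source, so the
  in-arcs of \<open>x\<close> form the fibre of \<sigma> over \<open>x\<close>.\<close>

definition N_set_graph :: "'v set \<Rightarrow> ('v \<Rightarrow> 'v) \<Rightarrow> ('v, 'v) pre_digraph" where
  "N_set_graph S \<sigma> = \<lparr> verts = S, arcs = S, tail = (\<lambda>x. x), head = \<sigma> \<rparr>"

lemma wf_N_set_graph:
  assumes "\<And>x. x \<in> S \<Longrightarrow> \<sigma> x \<in> S"
  shows "wf_digraph (N_set_graph S \<sigma>)"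
  using assms by unfold_locales (auto simp: N_set_graph_def)

text \<open>As \<phi> is injective and commutes with the self-maps, it matches the fibre over
  \<open>x\<close> with the fibre over \<open>\<phi> x\<close>. The result is phrased as an epic
  covering so that it composes with other coverings.\<close>

lemma N_set_graph_epic_covering:
  assumes S: "\<And>x. x \<in> S \<Longrightarrow> \<sigma> x \<in> S" and T: "\<And>x. x \<in> T \<Longrightarrow> \<tau> x \<in> T"
    and \<phi>: "bij_betw \<phi> S T" "\<And>x. x \<in> S \<Longrightarrow> \<phi> (\<sigma> x) = \<tau> (\<phi> x)"
  shows "epic_covering (N_set_graph S \<sigma>) (N_set_graph T \<tau>) (\<phi>, \<phi>)"
proof -
  have im: "\<phi> ` S = T" and inj: "inj_on \<phi> S" using \<phi>(1) by (auto simp: bij_betw_def)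
  have "bij_betw \<phi> {y \<in> S. \<sigma> y = x} {y \<in> T. \<tau> y = \<phi> x}" if x: "x \<in> S" for x
  proof (rule bij_betw_imageI)
    show "inj_on \<phi> {y \<in> S. \<sigma> y = x}" using inj by (rule inj_on_subset) auto
    have "\<tau> (\<phi> y) = \<phi> x \<longleftrightarrow> \<sigma> y = x" if "y \<in> S" for y
      using \<phi>(2)[OF that] inj_on_eq_iff[OF inj S[OF that] x] by simp
    then show "\<phi> ` {y \<in> S. \<sigma> y = x} = {y \<in> T. \<tau> y = \<phi> x}" using im by auto
  qed
  then show ?thesis
    using wf_N_set_graph[of S \<sigma>, OF S] wf_N_set_graph[of T \<tau>, OF T] im \<phi>(2)
    by (auto simp: epic_covering_def covering_def graph_morphism_def N_set_graph_def in_arcs_def)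
qed

text \<open>Node \<open>n\<close> of a walk is the tail of arc \<open>n\<close>, so the arcs
  determine the walk, and its nodes lie in \<open>verts X\<close> by well-formedness.\<close>

lemma walks_iff:
  "w \<in> walks X \<longleftrightarrow> wf_digraph X \<and> (\<forall>n. snd w n \<in> arcs X \<and>
     tail X (snd w n) = fst w n \<and> head X (snd w n) = fst w (Suc n))"
proof -
  have "wf_digraph nat_graph" by unfold_locales (auto simp: nat_graph_def)
  then show ?thesis
    by (auto simp: walks_def graph_morphism_def nat_graph_def image_subset_iff)
      (metis wf_digraph.tail_in_verts)
qed

lemma shift_fibre_bij_betw:
  assumes w: "w \<in> walks X"
  shows "bij_betw (\<lambda>v. snd v 0) {v \<in> walks X. shift v = w} (in_arcs X (fst w 0))"
proof (rule bij_betwI')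
  fix u v assume "u \<in> {v \<in> walks X. shift v = w}" "v \<in> {v \<in> walks X. shift v = w}"
  then have u: "u \<in> walks X" and v: "v \<in> walks X" and sh: "shift u = shift v" by auto
  show "snd u 0 = snd v 0 \<longleftrightarrow> u = v"
  proof
    assume eq: "snd u 0 = snd v 0"
    \<comment> \<open>Arc 0 agrees by assumption and the later arcs by equality of the shifts; the
      nodes follow as tails.\<close>
    have "snd u n = snd v n" for n
      using eq sh by (cases n) (auto simp: shift_def fun_eq_iff)
    with u v show "u = v" by (auto simp: walks_iff prod_eq_iff fun_eq_iff)
  qed simp
next
  fix v assume "v \<in> {v \<in> walks X. shift v = w}"
  then show "snd v 0 \<in> in_arcs X (fst w 0)" by (auto simp: walks_iff shift_def)
next
  fix e assume e: "e \<in> in_arcs X (fst w 0)"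
  \<comment> \<open>This prepends \<open>e\<close> to \<open>w\<close>: the new source is the tail
    of \<open>e\<close>, and the head of \<open>e\<close> is the old source \<open>fst w 0\<close>,
    now node 1.\<close>
  define v where "v = (case_nat (tail X e) (fst w), case_nat e (snd w))"
  have "v \<in> walks X" using w e by (auto simp: walks_iff v_def split: nat.split)
  moreover have "shift v = w" by (simp add: v_def shift_def)
  ultimately show "\<exists>v \<in> {v \<in> walks X. shift v = w}. e = snd v 0"
    by (intro bexI[of _ v]) (auto simp: v_def)
qed

text \<open>The in-arcs of the node \<open>w\<close> are the walks whose shift is \<open>w\<close>,
  so \<open>shift_fibre_bij_betw\<close> is exactly the covering condition. Walkability gives
  surjectivity on nodes.\<close>

lemma walks_epic_covering:
  assumes wf: "wf_digraph X" and walk: "walkable X"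
  shows "epic_covering (N_set_graph (walks X) shift) X (\<lambda>w. fst w 0, \<lambda>w. snd w 0)"
proof -
  have "verts (walkable_subgraph X) = verts X" using walk by (simp add: walkable_def)
  then have V: "(\<lambda>w. fst w 0) ` walks X = verts X" by (simp add: walkable_subgraph_def)
  have "graph_morphism (N_set_graph (walks X) shift) X (\<lambda>w. fst w 0, \<lambda>w. snd w 0)"
    using wf wf_N_set_graph[of "walks X" shift, OF shift_in_walks] V
    by (auto simp: graph_morphism_def N_set_graph_def walks_iff shift_def)
  with V shift_fibre_bij_betw show ?thesis
    by (auto simp: epic_covering_def covering_def N_set_graph_def in_arcs_def)
qed

theorem mainTheorem6:
  fixes X :: "('a, 'b) pre_digraph" and Y :: "('c, 'd) pre_digraph"
    and BX :: "('e, 'f) pre_digraph" and BY :: "('g, 'h) pre_digraph"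
  assumes "wf_digraph X" and "wf_digraph Y"
    and "walkable X" and "walkable Y"
    and "N_equivalent X Y"
    and "is_basal_graph_of BX X" and "is_basal_graph_of BY Y"
  shows "digraph_iso BX BY"
proof -
  obtain p where BX: "basal BX" and p: "epic_covering X BX p"
    using assms(6) by (auto simp: is_basal_graph_of_def)
  obtain q where BY: "basal BY" and q: "epic_covering Y BY q"
    using assms(7) by (auto simp: is_basal_graph_of_def)
  obtain \<phi> where \<phi>: "bij_betw \<phi> (walks X) (walks Y)"
      "\<And>w. w \<in> walks X \<Longrightarrow> \<phi> (shift w) = shift (\<phi> w)"
    using assms(5) by (auto simp: N_equivalent_def N_set_iso_def)
  have "epic_covering (N_set_graph (walks X) shift) (N_set_graph (walks Y) shift) (\<phi>, \<phi>)"
    by (intro N_set_graph_epic_covering shift_in_walks \<phi>)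
  \<comment> \<open>Both basal graphs are now covered by the graph of \<open>walks X\<close>:
    \<open>BY\<close> through \<phi>, the walks of \<open>Y\<close> and \<open>q\<close>, and
    \<open>BX\<close> through \<open>X\<close> and \<open>p\<close>.\<close>
  from epic_covering_compose[OF epic_covering_compose[OF this walks_epic_covering] q]
    epic_covering_compose[OF walks_epic_covering p]
  have "\<exists>f. graph_isomorphism BX BY f"
    using assms(1-4) BX BY by (blast intro: epic_covering_basal_unique)
  then show ?thesis
    using BX BY by (simp add: digraph_iso_iff_graph_isomorphism basal_def)
qed

end
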